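(* Let $n \ge 1$ and let $K(x,y)$ be the transition matrix of the binary Burnside process on $C_2^n$. Then: 1. The eigenvalues of $K$ are $0$ and $$\beta_k = \frac{1}{2^{4k}}\binom{2k}{k}^2, \qquad 0 \le k \le \left\lfloor \frac{n}{2}\right\rfloor.$$ 2. The eigenvalue multiplicity of $0$ is $2^{n-1}$. The eigenvalue multiplicity of $\beta_k$ is $\binom{n}{2k}$ for all $0 \le k \le \lfloor \frac{n}{2}\rfloor$. 3. For $0 \le k \le \lfloor \frac n2 \rfloor$, a basis of (right) eigenvectors for the $\beta_k$-eigenspace is $$\left\{ f_S(x) = (-1)^{|x_S|}\binom{2k}{|x_S|} : S \subseteq [n],\ |S| = 2k \right\},$$ where $|x_S|$ denotes the number of ones of $x \in C_2^n$ among the coordinate set $S$.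
   Context: $C_2^n = \{0,1\}^n$ is the set of binary $n$-tuples and $[n] = \{1,\dots,n\}$. The symmetric group $S_n$ acts on $C_2^n$ by permuting coordinates. The binary Burnside process on $C_2^n$ is the Markov chain which from $x$ chooses $s$ uniformly from the stabilizer $G_x = \{s \in S_n : s \text{ fixes } x\}$ and then chooses $y$ uniformly from $\mathfrak{X}_s = \{y \in C_2^n : s \text{ fixes } y\}$; its transition matrix is $$K(x,y) = \frac{1}{|G_x|}\sum_{s \in G_x \cap G_y} \frac{1}{|\mathfrak{X}_s|}.$$ $K$ acts on functions $f: C_2^n \to \mathbb{R}$ by $Kf(x) = \sum_y K(x,y) f(y)$; eigenvectors are with respect to this action. *)

theory Defs
  imports "HOL-Analysis.Analysis" "HOL-Combinatorics.Permutations"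
begin

text \<open>
  The coordinate set $[n]$ is a finite type \<open>'n\<close> with $n = $ \<open>CARD('n)\<close>, so $n \ge 1$ holds
  automatically. A binary tuple $x \in C_2^n$ is an element of \<open>bool ^ 'n\<close>, with \<open>True\<close> for $1$
  and \<open>False\<close> for $0$. A function $f : C_2^n \to R$ is a vector in \<open>real ^ (bool ^ 'n)\<close>,
  and a matrix over $C_2^n$ acts on it by \<open>*v\<close>.
\<close>

text \<open>The inverse makes this a left action.\<close>

definition permute_coords :: "('n::finite \<Rightarrow> 'n) \<Rightarrow> bool ^ 'n \<Rightarrow> bool ^ 'n" where
  "permute_coords s x = (\<chi> i. x $ inv s i)"

definition stabilizer_perms :: "bool ^ 'n::finite \<Rightarrow> ('n \<Rightarrow> 'n) set" where
  "stabilizer_perms x = {s. s permutes UNIV \<and> permute_coords s x = x}"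

definition fixed_tuples :: "('n::finite \<Rightarrow> 'n) \<Rightarrow> (bool ^ 'n) set" where
  "fixed_tuples s = {y. permute_coords s y = y}"

definition burnside_matrix :: "real ^ (bool ^ 'n::finite) ^ (bool ^ 'n)" where
  "burnside_matrix = (\<chi> x y.
     1 / real (card (stabilizer_perms x)) *
     (\<Sum>s \<in> stabilizer_perms x \<inter> stabilizer_perms y. 1 / real (card (fixed_tuples s))))"

definition eigenspace :: "real ^ 'm::finite ^ 'm \<Rightarrow> real \<Rightarrow> (real ^ 'm) set" where
  "eigenspace A c = {v. A *v v = c *\<^sub>R v}"

definition is_eigenvalue :: "real ^ 'm::finite ^ 'm \<Rightarrow> real \<Rightarrow> bool" where
  "is_eigenvalue A c \<longleftrightarrow> (\<exists>v. v \<noteq> 0 \<and> A *v v = c *\<^sub>R v)"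

definition burnside_eigval :: "nat \<Rightarrow> real" where
  "burnside_eigval k = 1 / 2 ^ (4 * k) * (real ((2 * k) choose k))\<^sup>2"

definition ones_in :: "'n::finite set \<Rightarrow> bool ^ 'n \<Rightarrow> nat" where
  "ones_in S x = card {i \<in> S. x $ i}"

text \<open>The parameter \<open>k\<close> is tied to \<open>S\<close> by $|S| = 2k$ wherever this vector is used.\<close>

definition burnside_eigvec :: "nat \<Rightarrow> 'n::finite set \<Rightarrow> real ^ (bool ^ 'n)" where
  "burnside_eigvec k S = (\<chi> x. (-1) ^ ones_in S x * real ((2 * k) choose ones_in S x))"

end

theory Submission
  imports Defs "HOL-Computational_Algebra.Formal_Power_Series"
begin

text \<open>
  For every \<open>S \<subseteq> [n]\<close>, of even or odd size, the function
  $f_S(x) = (-1)^{|x_S|} {|S| \choose |x_S|}$ is an eigenvector of $K$, with eigenvalue $0$ when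
  $|S|$ is odd; these $2^n$ functions form a basis.

  Building permutations up by transpositions gives $K(x,y)$ as a product over $b \in \{0,1\}$ of
  weights $E[\theta^i (1-\theta)^j]$ with $\theta$ arcsine distributed and $i$, $j$ the numbers of
  ones and zeros of $y$ on $\{x = b\}$. Hence the kernel is consistent under forgetting coordinates,
  so that $K f_S$ is computed by the same kernel on $S$. This kernel is reversible for the weight
  $|x_S|!\,(|S|-|x_S|)!$, and $f_S$ is $|S|!$ times the parity $(-1)^{|x_S|}$ divided by that weight,
  so it suffices that the parity is a left eigenvector. Its image under the left action changes sign
  whenever a coordinate of $S$ is flipped, because summing over a coordinate of the kernel forgets it.
  The eigenvalue is the image at the zero tuple, the sum of
  $(-1)^j {m \choose j} \alpha_j \alpha_{m-j}$ over $j$ for $m = |S|$ and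
  $\alpha_j = 4^{-j} {2j \choose j}$. Its exponential generating function is
  $e^{t/2} I_0(t/2) \cdot e^{-t/2} I_0(t/2) = I_0(t/2)^2$.
\<close>

section \<open>Flipping a single coordinate\<close>

definition flip :: "'n::finite \<Rightarrow> bool ^ 'n \<Rightarrow> bool ^ 'n" where
  "flip a y = (\<chi> i. if i = a then \<not> y $ i else y $ i)"

lemma flip_nth: "flip a y $ i = (if i = a then \<not> y $ i else y $ i)"
  by (simp add: flip_def)

lemma flip_flip [simp]: "flip a (flip a y) = y"
  by (simp add: vec_eq_iff flip_nth)

lemma bij_flip: "bij (flip a)"
  by (rule o_bij[of "flip a"]) (auto simp: fun_eq_iff)

lemma sum_flip: "(\<Sum>y\<in>UNIV. g (flip a y)) = (\<Sum>y\<in>UNIV. g y)"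
  using sum.reindex_bij_betw[OF bij_flip] .

section \<open>Weighted sums over colour-preserving permutations\<close>

lemma mem_fixed_tuples:
  assumes "s permutes UNIV"
  shows "y \<in> fixed_tuples s \<longleftrightarrow> (\<forall>i. y $ s i = y $ i)"
proof -
  have "y \<in> fixed_tuples s \<longleftrightarrow> (\<forall>i. y $ inv s i = y $ i)"
    by (simp add: fixed_tuples_def permute_coords_def vec_eq_iff)
  also have "\<dots> \<longleftrightarrow> (\<forall>i. y $ s i = y $ i)"
    using assms by (metis permutes_inverses)
  finally show ?thesis .
qed

lemma stabilizer_perms_eq:
  "stabilizer_perms x = {s. s permutes UNIV \<and> (\<forall>i. x $ s i = x $ i)}"
  using mem_fixed_tuples by (auto simp: stabilizer_perms_def fixed_tuples_def)

text \<open>Since \<open>p\<close> fixes \<open>a\<close>, the composite sends \<open>a\<close> to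
  \<open>b\<close>; this forces equal colours at \<open>a\<close> and \<open>b\<close>, after which
  the transposition is invisible to \<open>c\<close>.\<close>

lemma invariant_transpose_comp_iff:
  assumes "p permutes S" "a \<notin> S"
  shows "(\<forall>i. c ((Transposition.transpose a b \<circ> p) i) = c i) \<longleftrightarrow> c a = c b \<and> (\<forall>i. c (p i) = c i)"
proof
  assume L: "\<forall>i. c ((Transposition.transpose a b \<circ> p) i) = c i"
  have "p a = a" using assms by (simp add: permutes_def)
  then have "c a = c b" using spec[OF L, of a] by simp
  moreover from this have "c (Transposition.transpose a b j) = c j" for j
    by (auto simp: Transposition.transpose_def)
  ultimately show "c a = c b \<and> (\<forall>i. c (p i) = c i)" using L by simp
next
  assume R: "c a = c b \<and> (\<forall>i. c (p i) = c i)"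
  then have "c (Transposition.transpose a b j) = c j" for j
    by (auto simp: Transposition.transpose_def)
  with R show "\<forall>i. c ((Transposition.transpose a b \<circ> p) i) = c i" by simp
qed

text \<open>The transposition merges the fixed point \<open>a\<close> of \<open>p\<close> into the
  cycle of \<open>b\<close>. A tuple fixed by \<open>p\<close> may take either value at
  \<open>a\<close>, while one fixed by the composite must agree there with \<open>b\<close>;
  \<open>flip a\<close> exchanges the two halves.\<close>

lemma card_fixed_tuples_transpose_comp:
  assumes "p permutes S" "a \<notin> S" "b \<in> S"
  shows "card (fixed_tuples p) = 2 * card (fixed_tuples (Transposition.transpose a b \<circ> p))"
proof -
  let ?q = "Transposition.transpose a b \<circ> p"
  have p: "p permutes UNIV" using assms(1) permutes_subset by blast
  have q: "?q permutes UNIV" by (intro permutes_compose[OF p] permutes_swap_id) auto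
  have pa: "p a = a" using assms by (simp add: permutes_def)
  have pia: "p i = a \<longleftrightarrow> i = a" for i using pa p by (metis permutes_inverses(2))
  have ab: "a \<noteq> b" using assms by auto
  have Q: "fixed_tuples ?q = {y \<in> fixed_tuples p. y $ a = y $ b}"
    unfolding set_eq_iff mem_Collect_eq mem_fixed_tuples[OF p] mem_fixed_tuples[OF q]
    using invariant_transpose_comp_iff[OF assms(1,2), where b=b] by blast
  have inv: "flip a y \<in> fixed_tuples p \<longleftrightarrow> y \<in> fixed_tuples p" for y
    by (auto simp: mem_fixed_tuples[OF p] flip_nth pia)
  have "fixed_tuples p = fixed_tuples ?q \<union> flip a ` fixed_tuples ?q"
  proof (intro equalityI subsetI)
    fix y assume y: "y \<in> fixed_tuples p"
    show "y \<in> fixed_tuples ?q \<union> flip a ` fixed_tuples ?q"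
    proof (cases "y $ a = y $ b")
      case False
      then have "flip a y \<in> fixed_tuples ?q" using y ab by (simp add: Q inv flip_nth)
      then show ?thesis by (metis UnI2 flip_flip imageI)
    qed (use y Q in auto)
  qed (auto simp: Q inv)
  moreover have "fixed_tuples ?q \<inter> flip a ` fixed_tuples ?q = {}"
    using ab by (auto simp: Q flip_nth)
  moreover have "card (flip a ` fixed_tuples ?q) = card (fixed_tuples ?q)"
    using bij_flip by (metis bij_is_inj card_image inj_on_subset subset_UNIV)
  ultimately show ?thesis by (simp add: card_Un_disjoint)
qed

text \<open>Inserting \<open>a\<close> into \<open>S\<close> writes each permutation as \<open>p\<close> or \<open>transpose a b \<circ> p\<close> with
  \<open>b \<in> S\<close>, which preserves the colouring only if \<open>a\<close> and \<open>b\<close> have the same colour.\<close>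

lemma sum_colour_preserving_perms:
  fixes w :: "('n::finite \<Rightarrow> 'n) \<Rightarrow> real" and c :: "'n \<Rightarrow> 'c::finite"
  assumes w: "\<And>S p a b. p permutes S \<Longrightarrow> a \<notin> S \<Longrightarrow> b \<in> S \<Longrightarrow> w (Transposition.transpose a b \<circ> p) = t * w p"
  shows "(\<Sum>p | p permutes S \<and> (\<forall>i. c (p i) = c i). w p)
    = w id * (\<Prod>\<gamma>\<in>UNIV. \<Prod>i<card {j\<in>S. c j = \<gamma>}. 1 + t * real i)"
proof (induction S rule: infinite_finite_induct)
  case empty
  have "{p. p permutes {} \<and> (\<forall>i. c (p i) = c i)} = {id}" by auto
  then show ?case by simp
next
  case (insert a S)
  let ?I = "\<lambda>p. \<forall>i. c (p i) = c i"
  let ?R = "\<lambda>T. \<Prod>\<gamma>\<in>UNIV. \<Prod>i<card {j\<in>T. c j = \<gamma>}. 1 + t * real i"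
  let ?E = "\<lambda>T. \<Sum>p | p permutes T \<and> ?I p. w p"
  have E: "?E T = (\<Sum>p | p permutes T. if ?I p then w p else 0)" for T
    by (subst sum.inter_filter[symmetric]) (auto intro: finite_permutations)
  \<comment> \<open>The choice \<open>b = a\<close> is the identity transposition and keeps
    \<open>a\<close> fixed; any other admissible \<open>b\<close> costs one factor
    \<open>t\<close>.\<close>
  have step: "(\<Sum>p | p permutes S. if ?I (Transposition.transpose a b \<circ> p) then w (Transposition.transpose a b \<circ> p) else 0)
      = (if b = a then 1 else if c a = c b then t else 0) * ?E S" if "b \<in> insert a S" for b
    unfolding E sum_distrib_left
  proof (intro sum.cong refl)
    fix p assume "p \<in> {p. p permutes S}"
    then have p: "p permutes S" by simp
    show "(if ?I (Transposition.transpose a b \<circ> p) then w (Transposition.transpose a b \<circ> p) else 0)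
      = (if b = a then 1 else if c a = c b then t else 0) * (if ?I p then w p else 0)"
      using invariant_transpose_comp_iff[OF p insert(2), of c b] w[OF p insert(2), of b] that
      by (auto simp del: o_apply)
  qed
  have "?E (insert a S) = (\<Sum>b\<in>insert a S. (if b = a then 1 else if c a = c b then t else 0) * ?E S)"
    unfolding E[of "insert a S"] sum_over_permutations_insert[OF insert(1,2)]
    using step by (intro sum.cong refl) auto
  also have "\<dots> = (1 + (\<Sum>b\<in>S. if c b = c a then t else 0)) * ?E S"
  proof -
    have "(\<Sum>b\<in>S. (if b = a then 1 else if c a = c b then t else 0) * ?E S)
      = (\<Sum>b\<in>S. (if c b = c a then t else 0) * ?E S)"
      using insert(2) by (intro sum.cong) auto
    then show ?thesis
      using insert(1,2) by (simp add: sum_distrib_right distrib_right)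
  qed
  also have "(\<Sum>b\<in>S. if c b = c a then t else 0) = t * real (card {j\<in>S. c j = c a})"
    using insert(1) by (simp add: sum.inter_filter[symmetric])
  \<comment> \<open>Only the colour class of \<open>a\<close> grows, and its product gains exactly
    this factor.\<close>
  also have "(1 + t * real (card {j\<in>S. c j = c a})) * ?E S = w id * ?R (insert a S)"
  proof -
    have ne: "{j\<in>insert a S. c j = \<gamma>} = {j\<in>S. c j = \<gamma>}" if "\<gamma> \<noteq> c a" for \<gamma>
      using that by auto
    have rest: "(\<Prod>\<gamma>\<in>UNIV - {c a}. \<Prod>i<card {j\<in>insert a S. c j = \<gamma>}. 1 + t * real i)
      = (\<Prod>\<gamma>\<in>UNIV - {c a}. \<Prod>i<card {j\<in>S. c j = \<gamma>}. 1 + t * real i)"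
      by (rule prod.cong[OF refl]) (simp add: ne singleton_iff del: insert_iff)
    have "{j\<in>insert a S. c j = c a} = insert a {j\<in>S. c j = c a}" by auto
    then have eq: "card {j\<in>insert a S. c j = c a} = Suc (card {j\<in>S. c j = c a})"
      using insert(1,2) by simp
    show ?thesis unfolding insert(3)
      by (subst (1 2) prod.remove[OF _ UNIV_I[of "c a"]]) (simp_all add: eq rest del: insert_iff)
  qed
  finally show ?case .
qed simp

section \<open>Arcsine moments and the closed form of the kernel\<close>

definition odd_fact :: "nat \<Rightarrow> real" where
  "odd_fact m = (\<Prod>i<m. 1 + 2 * real i)"

text \<open>The moment $E[\theta^i (1-\theta)^j]$ of the arcsine law $\mathrm{Beta}(1/2, 1/2)$.\<close>

definition arcsine :: "nat \<Rightarrow> nat \<Rightarrow> real" where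
  "arcsine i j = odd_fact i * odd_fact j / (2 ^ (i + j) * fact (i + j))"

definition marginal_kernel :: "'n::finite set \<Rightarrow> bool ^ 'n \<Rightarrow> bool ^ 'n \<Rightarrow> real" where
  "marginal_kernel S x y =
    arcsine (card {i\<in>S. x $ i \<and> y $ i}) (card {i\<in>S. x $ i \<and> \<not> y $ i}) *
    arcsine (card {i\<in>S. \<not> x $ i \<and> y $ i}) (card {i\<in>S. \<not> x $ i \<and> \<not> y $ i})"

lemma fact_eq_prod: "fact m = (\<Prod>i<m. 1 + real i)"
  by (induction m) (simp_all add: mult.commute)

lemma card_split: "card {i\<in>S. P i} = card {i\<in>S. P i \<and> Q i} + card {i\<in>S. P i \<and> \<not> Q i}"
  for S :: "'n::finite set"
  by (subst card_Un_disjoint[symmetric]) (auto intro!: arg_cong[of _ _ card])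

lemma card_fixed_tuples_id: "card (fixed_tuples (id :: 'n::finite \<Rightarrow> 'n)) = 2 ^ CARD('n)"
proof -
  have "fixed_tuples (id :: 'n \<Rightarrow> 'n) = UNIV"
    by (auto simp: mem_fixed_tuples permutes_id)
  then show ?thesis by simp
qed

text \<open>The colour sum is used twice: colours \<open>x $ i\<close> with \<open>t = 1\<close>
  count the stabilizer, and colours \<open>(x $ i, y $ i)\<close> with \<open>t = 2\<close> evaluate
  the sum over the common stabilizer, since each transposition halves the number of fixed
  tuples.\<close>

lemma burnside_matrix_eq: "burnside_matrix $ x $ y = marginal_kernel UNIV x y"
proof -
  let ?n = "\<lambda>P. card {i. P i}"
  have "(\<Sum>p | p permutes UNIV \<and> (\<forall>i. x $ p i = x $ i). 1 :: real)
    = 1 * (\<Prod>\<gamma>\<in>UNIV. \<Prod>i<card {j\<in>UNIV. x $ j = \<gamma>}. 1 + 1 * real i)"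
    by (rule sum_colour_preserving_perms) simp
  then have G: "real (card (stabilizer_perms x)) = fact (?n (\<lambda>i. x $ i)) * fact (?n (\<lambda>i. \<not> x $ i))"
    by (simp add: stabilizer_perms_eq UNIV_bool fact_eq_prod mult.commute)
  have "(\<Sum>p | p permutes UNIV \<and> (\<forall>i. (x $ p i, y $ p i) = (x $ i, y $ i)). 1 / real (card (fixed_tuples p)))
    = 1 / real (card (fixed_tuples (id :: 'a \<Rightarrow> 'a))) *
      (\<Prod>\<gamma>\<in>UNIV. \<Prod>i<card {j\<in>UNIV. (x $ j, y $ j) = \<gamma>}. 1 + 2 * real i)"
  proof (rule sum_colour_preserving_perms)
    fix S :: "'a set" and p a b assume "p permutes S" "a \<notin> S" "b \<in> S"
    from card_fixed_tuples_transpose_comp[OF this]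
    show "1 / real (card (fixed_tuples (Transposition.transpose a b \<circ> p))) = 2 * (1 / real (card (fixed_tuples p)))"
      by simp
  qed
  moreover have "stabilizer_perms x \<inter> stabilizer_perms y
    = {p. p permutes UNIV \<and> (\<forall>i. (x $ p i, y $ p i) = (x $ i, y $ i))}"
    by (auto simp: stabilizer_perms_eq)
  ultimately have "(\<Sum>s\<in>stabilizer_perms x \<inter> stabilizer_perms y. 1 / real (card (fixed_tuples s)))
    = 1 / 2 ^ CARD('a) * (odd_fact (?n (\<lambda>i. x $ i \<and> y $ i)) * odd_fact (?n (\<lambda>i. x $ i \<and> \<not> y $ i)) *
       (odd_fact (?n (\<lambda>i. \<not> x $ i \<and> y $ i)) * odd_fact (?n (\<lambda>i. \<not> x $ i \<and> \<not> y $ i))))"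
    by (simp add: UNIV_Times_UNIV[symmetric] UNIV_bool card_fixed_tuples_id odd_fact_def
        insert_Times_insert del: UNIV_Times_UNIV)
  moreover have "CARD('a) = ?n (\<lambda>i. x $ i) + ?n (\<lambda>i. \<not> x $ i)"
    using card_split[of UNIV "\<lambda>_. True" "\<lambda>i. x $ i"] by simp
  ultimately show ?thesis
    using card_split[of UNIV "\<lambda>i. x $ i" "\<lambda>i. y $ i"] card_split[of UNIV "\<lambda>i. \<not> x $ i" "\<lambda>i. y $ i"]
    by (simp add: burnside_matrix_def G marginal_kernel_def arcsine_def power_add)
qed

text \<open>In terms of moments this is theta + (1 - theta) = 1.\<close>

lemma arcsine_rec: "arcsine (Suc i) j + arcsine i (Suc j) = arcsine i j"
proof -
  have "odd_fact (Suc i) * odd_fact j + odd_fact i * odd_fact (Suc j)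
      = 2 * real (Suc (i + j)) * (odd_fact i * odd_fact j)"
    by (simp add: odd_fact_def algebra_simps)
  then have "arcsine (Suc i) j + arcsine i (Suc j)
    = 2 * real (Suc (i + j)) * (odd_fact i * odd_fact j) / (2 ^ Suc (i + j) * fact (Suc (i + j)))"
    by (simp only: arcsine_def add_Suc add_Suc_right add_divide_distrib[symmetric])
  also have "\<dots> = arcsine i j" by (simp add: arcsine_def divide_simps)
  finally show ?thesis .
qed

section \<open>Forgetting coordinates, and reversibility\<close>

lemma card_Collect_insert:
  fixes S :: "'n::finite set"
  assumes "a \<notin> S"
  shows "card {i \<in> insert a S. P i} = (if P a then Suc (card {i \<in> S. P i}) else card {i \<in> S. P i})"
proof -
  have "{i \<in> insert a S. P i} = (if P a then insert a {i \<in> S. P i} else {i \<in> S. P i})" by auto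
  then show ?thesis using assms by simp
qed

lemma Collect_flip:
  assumes "a \<notin> S"
  shows "{i \<in> S. P i (flip a y $ i)} = {i \<in> S. P i (y $ i)}"
  using assms by (auto simp: flip_nth)

lemma marginal_kernel_flip:
  assumes "a \<notin> S"
  shows "marginal_kernel S x (flip a y) = marginal_kernel S x y"
    and "marginal_kernel S (flip a x) y = marginal_kernel S x y"
  using Collect_flip[OF assms, of "\<lambda>i b. x $ i \<and> b"] Collect_flip[OF assms, of "\<lambda>i b. x $ i \<and> \<not> b"]
    Collect_flip[OF assms, of "\<lambda>i b. \<not> x $ i \<and> b"] Collect_flip[OF assms, of "\<lambda>i b. \<not> x $ i \<and> \<not> b"]
    Collect_flip[OF assms, of "\<lambda>i b. b \<and> y $ i"] Collect_flip[OF assms, of "\<lambda>i b. b \<and> \<not> y $ i"]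
    Collect_flip[OF assms, of "\<lambda>i b. \<not> b \<and> y $ i"] Collect_flip[OF assms, of "\<lambda>i b. \<not> b \<and> \<not> y $ i"]
  by (simp_all add: marginal_kernel_def)

text \<open>The coordinate \<open>a\<close> enters only the factor for the value
  \<open>x $ a\<close>; its two possible values in \<open>y\<close> give the two terms of
  \<open>arcsine_rec\<close>.\<close>

lemma marginal_kernel_insert:
  assumes "a \<notin> S"
  shows "marginal_kernel (insert a S) x y + marginal_kernel (insert a S) x (flip a y)
    = marginal_kernel S x y"
proof -
  have "flip a y $ a \<longleftrightarrow> \<not> y $ a" by (simp add: flip_nth)
  moreover note arcsine_rec arcsine_rec[unfolded add.commute[of "arcsine (Suc _) _"]]
    Collect_flip[OF assms, of "\<lambda>i b. x $ i \<and> b" y] Collect_flip[OF assms, of "\<lambda>i b. x $ i \<and> \<not> b" y]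
    Collect_flip[OF assms, of "\<lambda>i b. \<not> x $ i \<and> b" y] Collect_flip[OF assms, of "\<lambda>i b. \<not> x $ i \<and> \<not> b" y]
  ultimately show ?thesis
    by (simp add: marginal_kernel_def card_Collect_insert[OF assms]
      distrib_right[symmetric] distrib_left[symmetric] del: insert_iff)
qed

text \<open>The number of permutations of \<open>S\<close> that preserve \<open>x\<close> on
  \<open>S\<close>, i.e. the stabilizer order when \<open>S\<close> is everything.\<close>

definition orbit_weight :: "'n::finite set \<Rightarrow> bool ^ 'n \<Rightarrow> real" where
  "orbit_weight S x = fact (card {i\<in>S. x $ i}) * fact (card {i\<in>S. \<not> x $ i})"

text \<open>The weight cancels the factorials in the denominators. What remains is a product of
  \<open>odd_fact\<close> over the four blocks, divided by a power of 2 depending on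
  \<open>card S\<close> only, and exchanging \<open>x\<close> and \<open>y\<close> just swaps two
  blocks.\<close>

lemma marginal_kernel_reversible:
  "orbit_weight S x * marginal_kernel S x y = orbit_weight S y * marginal_kernel S y x"
  using card_split[of S "\<lambda>i. x $ i" "\<lambda>i. y $ i"] card_split[of S "\<lambda>i. \<not> x $ i" "\<lambda>i. y $ i"]
    card_split[of S "\<lambda>i. y $ i" "\<lambda>i. x $ i"] card_split[of S "\<lambda>i. \<not> y $ i" "\<lambda>i. x $ i"]
  by (simp add: orbit_weight_def marginal_kernel_def arcsine_def power_add conj_commute mult_ac)

text \<open>Coordinates of \<open>R\<close> are summed out one by one by pairing \<open>y\<close>
  with \<open>flip a y\<close>. The sums still run over the whole cube, so each pair is counted
  twice; hence the power of 2.\<close>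

lemma sum_marginal_kernel:
  assumes "S \<inter> R = {}" "\<And>a y. a \<notin> S \<Longrightarrow> f (flip a y) = f y"
  shows "2 ^ card R * (\<Sum>y\<in>UNIV. marginal_kernel (S \<union> R) x y * f y)
    = (\<Sum>y\<in>UNIV. marginal_kernel S x y * f y)"
  using assms(1)
proof (induction R rule: infinite_finite_induct)
  case (insert a R)
  let ?T = "S \<union> R"
  have a: "a \<notin> ?T" using insert by auto
  have "2 * (\<Sum>y\<in>UNIV. marginal_kernel (insert a ?T) x y * f y)
    = (\<Sum>y\<in>UNIV. marginal_kernel (insert a ?T) x y * f y)
      + (\<Sum>y\<in>UNIV. marginal_kernel (insert a ?T) x (flip a y) * f (flip a y))"
    unfolding sum_flip[of "\<lambda>y. marginal_kernel (insert a ?T) x y * f y"] by simp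
  also have "\<dots> = (\<Sum>y\<in>UNIV. marginal_kernel ?T x y * f y)"
    using a assms(2)[of a]
    by (simp add: sum.distrib[symmetric] distrib_right[symmetric] marginal_kernel_insert)
  finally show ?case using insert by (simp add: mult.assoc mult.left_commute[of 2])
qed simp_all

section \<open>The parity as a left eigenvector\<close>

definition parity :: "'n::finite set \<Rightarrow> bool ^ 'n \<Rightarrow> real" where
  "parity S x = (-1) ^ ones_in S x"

lemma ones_in_flip: "a \<notin> S \<Longrightarrow> ones_in S (flip a x) = ones_in S x"
  using Collect_flip[of a S "\<lambda>i b. b" x] by (simp add: ones_in_def)

lemma parity_flip:
  "parity S (flip a x) = (if a \<in> S then - parity S x else parity S x)"
proof (cases "a \<in> S")
  case True
  define T where "T = S - {a}"
  have T: "a \<notin> T" "S = insert a T" using True by (auto simp: T_def)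
  show ?thesis
    using ones_in_flip[OF T(1), of x]
    by (simp add: parity_def T ones_in_def card_Collect_insert[OF T(1)] flip_nth insertI1 del: insert_iff)
qed (simp add: parity_def ones_in_flip)

lemma parity_mult_self [simp]: "parity S x * parity S x = 1"
  by (simp add: parity_def flip: power_add)

text \<open>Any tuple reaches the zero tuple by flipping its ones away.\<close>

lemma flip_invariant_imp_const:
  assumes "\<And>a x. g (flip a x) = g x"
  shows "g x = g (\<chi> i. False)"
proof (induction "ones_in UNIV x" arbitrary: x)
  case 0
  then have "x = (\<chi> i. False)" by (auto simp: ones_in_def vec_eq_iff)
  then show ?case by simp
next
  case (Suc m)
  then have "{i. x $ i} \<noteq> {}"
    unfolding ones_in_def by (metis (no_types, lifting) Collect_cong UNIV_I Zero_not_Suc card.empty)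
  then obtain a where a: "x $ a" by auto
  have "{i. flip a x $ i} = {i. x $ i} - {a}" using a by (auto simp: flip_nth)
  then have "ones_in UNIV (flip a x) = m" using Suc(2) a by (simp add: ones_in_def)
  then show ?case using Suc(1)[of "flip a x"] assms by simp
qed

text \<open>Left action on \<open>parity S\<close>: adding up the values at \<open>x\<close> and at \<open>x\<close> flipped in a coordinate
  \<open>a \<in> S\<close> replaces the kernel by one that ignores \<open>a\<close>, and the parity sums to zero against it.\<close>

lemma sum_parity_marginal_kernel:
  "(\<Sum>y\<in>UNIV. parity S y * marginal_kernel S y x)
    = parity S x * (\<Sum>y\<in>UNIV. parity S y * marginal_kernel S y (\<chi> i. False))"
proof -
  define h where "h x = (\<Sum>y\<in>UNIV. parity S y * marginal_kernel S y x)" for x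
  have h: "h (flip a x) = (if a \<in> S then - h x else h x)" for a x
  proof (cases "a \<in> S")
    case True
    define T where "T = S - {a}"
    have T: "a \<notin> T" "S = insert a T" using True by (auto simp: T_def)
    let ?H = "\<Sum>y\<in>UNIV. parity S y * marginal_kernel T y x"
    have "h x + h (flip a x) = ?H"
      by (simp add: h_def sum.distrib[symmetric] distrib_left[symmetric] T(2) marginal_kernel_insert[OF T(1)])
    moreover have "?H = - ?H"
      using True T(1) by (subst sum_flip[of _ a, symmetric]) (simp add: parity_flip marginal_kernel_flip sum_negf)
    ultimately show ?thesis using True by simp
  qed (simp add: h_def marginal_kernel_flip)
  \<comment> \<open>Both factors change sign for flips inside \<open>S\<close> and neither does
    outside, so the product is constant.\<close>
  have "parity S x * h x = parity S (\<chi> i. False) * h (\<chi> i. False)"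
    by (rule flip_invariant_imp_const) (simp add: h parity_flip)
  also have "parity S (\<chi> i. False) = 1" by (simp add: parity_def ones_in_def)
  finally have "parity S x * (parity S x * h x) = parity S x * h (\<chi> i. False)" by simp
  then show ?thesis by (simp add: h_def flip: mult.assoc)
qed

section \<open>The eigenvectors and their eigenvalues\<close>

lemma sum_ones_in:
  fixes S :: "'n::finite set" and g :: "nat \<Rightarrow> real"
  shows "2 ^ card S * (\<Sum>y\<in>UNIV. g (ones_in S y))
    = 2 ^ CARD('n) * (\<Sum>j\<le>card S. real (card S choose j) * g j)"
proof (induction S arbitrary: g rule: infinite_finite_induct)
  case (insert a S)
  have "2 * (\<Sum>y\<in>UNIV. g (ones_in (insert a S) y))
    = (\<Sum>y\<in>UNIV. g (ones_in (insert a S) y)) + (\<Sum>y\<in>UNIV. g (ones_in (insert a S) (flip a y)))"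
    unfolding sum_flip[of "\<lambda>y. g (ones_in (insert a S) y)"] by simp
  also have "\<dots> = (\<Sum>y\<in>UNIV. g (ones_in S y)) + (\<Sum>y\<in>UNIV. g (Suc (ones_in S y)))"
    unfolding sum.distrib[symmetric]
    using ones_in_flip[OF insert(2)]
    by (intro sum.cong) (auto simp: ones_in_def card_Collect_insert[OF insert(2)] flip_nth simp del: insert_iff)
  finally have "2 ^ card (insert a S) * (\<Sum>y\<in>UNIV. g (ones_in (insert a S) y))
    = 2 ^ CARD('n) * ((\<Sum>j\<le>card S. real (card S choose j) * g j)
       + (\<Sum>j\<le>card S. real (card S choose j) * g (Suc j)))"
    using insert(1,2) insert(3)[of g] insert(3)[of "\<lambda>j. g (Suc j)"]
    by (simp add: distrib_left mult.assoc mult.left_commute[of 2])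
  \<comment> \<open>Shifting the index prepares Pascal's rule; the extra top term vanishes because
    its binomial coefficient is zero.\<close>
  also have "(\<Sum>j\<le>card S. real (card S choose j) * g j)
      = g 0 + (\<Sum>j\<le>card S. real (card S choose Suc j) * g (Suc j))"
    using sum.atMost_Suc_shift[of "\<lambda>j. real (card S choose j) * g j" "card S"] by (simp add: binomial_eq_0)
  also have "\<dots> + (\<Sum>j\<le>card S. real (card S choose j) * g (Suc j))
    = (\<Sum>j\<le>card (insert a S). real (card (insert a S) choose j) * g j)"
    using insert(1,2) sum.atMost_Suc_shift[of "\<lambda>j. real (Suc (card S) choose j) * g j" "card S"]
    by (simp add: sum.distrib distrib_right)
  finally show ?case .
qed (simp_all add: ones_in_def)

text \<open>Here \<open>arcsine 0 j\<close> is $\alpha_j = 4^{-j} {2j \choose j}$.\<close>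

definition parity_eigval :: "nat \<Rightarrow> real" where
  "parity_eigval m = (\<Sum>j\<le>m. real (m choose j) * ((-1) ^ j * (arcsine 0 j * arcsine 0 (m - j))))"

lemma marginal_kernel_zero:
  "marginal_kernel S y (\<chi> i. False) = arcsine 0 (ones_in S y) * arcsine 0 (card S - ones_in S y)"
proof -
  have "card {i \<in> S. \<not> y $ i} = card S - ones_in S y"
    using card_split[of S "\<lambda>_. True" "\<lambda>i. y $ i"] by (simp add: ones_in_def)
  then show ?thesis by (simp add: marginal_kernel_def ones_in_def)
qed

text \<open>Indexing by \<open>card S\<close> instead of \<open>2 * k\<close> admits sets of odd
  size, which span the kernel of the matrix.\<close>

definition eigvec :: "'n::finite set \<Rightarrow> real ^ (bool ^ 'n)" where
  "eigvec S = (\<chi> x. (-1) ^ ones_in S x * real (card S choose ones_in S x))"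

lemma ones_in_le: "ones_in S x \<le> card S"
  by (auto simp: ones_in_def intro: card_mono)

lemma eigvec_nth: "eigvec S $ x = fact (card S) * parity S x / orbit_weight S x"
proof -
  have "card S - ones_in S x = card {i \<in> S. \<not> x $ i}"
    using card_split[of S "\<lambda>_. True" "\<lambda>i. x $ i"] by (simp add: ones_in_def)
  then show ?thesis
    using binomial_fact[OF ones_in_le[of S x], where ?'a = real]
    by (simp add: eigvec_def parity_def orbit_weight_def flip: ones_in_def)
qed

lemma burnside_matrix_mult_eigvec:
  "burnside_matrix *v eigvec S = parity_eigval (card S) *\<^sub>R (eigvec S :: real ^ (bool ^ 'n::finite))"
proof -
  have "(burnside_matrix *v eigvec S) $ x = parity_eigval (card S) * eigvec S $ x" for x :: "bool ^ 'n"
  proof -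
    let ?z = "\<chi> i. False" and ?w = "orbit_weight S"
    have w: "?w y \<noteq> 0" for y by (simp add: orbit_weight_def)
    \<comment> \<open>Reversibility turns the right action on \<open>eigvec S\<close> into the left
      action on the parity.\<close>
    have mk: "marginal_kernel S x y = ?w y * marginal_kernel S y x / ?w x" for y
      using marginal_kernel_reversible[of S x y] w[of x] by (simp add: field_simps)
    have "(burnside_matrix *v eigvec S) $ x = (\<Sum>y\<in>UNIV. marginal_kernel UNIV x y * eigvec S $ y)"
      by (simp add: matrix_vector_mult_def burnside_matrix_eq)
    then have "2 ^ card (- S) * (burnside_matrix *v eigvec S) $ x
      = (\<Sum>y\<in>UNIV. marginal_kernel S x y * eigvec S $ y)"
      using sum_marginal_kernel[of S "- S" "\<lambda>y. eigvec S $ y" x] by (simp add: eigvec_def ones_in_flip)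
    also have "\<dots> = (\<Sum>y\<in>UNIV. (fact (card S) / ?w x) * (parity S y * marginal_kernel S y x))"
      using w by (intro sum.cong) (simp_all add: eigvec_nth mk field_simps)
    also have "\<dots> = eigvec S $ x * (\<Sum>y\<in>UNIV. parity S y * marginal_kernel S y ?z)"
      by (simp only: sum_distrib_left[symmetric] sum_parity_marginal_kernel[of S x] eigvec_nth) simp
    also have "(\<Sum>y\<in>UNIV. parity S y * marginal_kernel S y ?z) = 2 ^ card (- S) * parity_eigval (card S)"
    proof -
      have c: "CARD('n) = card S + card (- S)"
        using card_Un_disjoint[of S "- S"] by (simp add: Compl_partition)
      have "2 ^ card S * (\<Sum>y\<in>UNIV. parity S y * marginal_kernel S y ?z)
        = 2 ^ card S * (2 ^ card (- S) * parity_eigval (card S))"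
        using sum_ones_in[of S "\<lambda>j. (-1) ^ j * (arcsine 0 j * arcsine 0 (card S - j))"]
        by (simp add: marginal_kernel_zero parity_def parity_eigval_def c power_add mult.assoc)
      then show ?thesis by simp
    qed
    finally show ?thesis by simp
  qed
  then show ?thesis by (simp add: vec_eq_iff)
qed

section \<open>Evaluating the eigenvalues by generating functions\<close>

lemma odd_fact_rec: "odd_fact (Suc m) = (1 + 2 * real m) * odd_fact m"
  by (simp add: odd_fact_def)

definition arcsine_fps :: "real \<Rightarrow> real fps" where
  "arcsine_fps t = Abs_fps (\<lambda>j. t ^ j * arcsine 0 j / fact j)"

text \<open>The Taylor series of $I_0(t/2)$.\<close>

definition bessel_fps :: "real fps" where
  "bessel_fps = Abs_fps (\<lambda>m. if even m then 1 / (16 ^ (m div 2) * (fact (m div 2))\<^sup>2) else 0)"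

text \<open>The modified Bessel equation of order zero, rescaled to the argument t/2.\<close>

lemma bessel_fps_ode:
  "fps_X * fps_deriv (fps_deriv bessel_fps) + fps_deriv bessel_fps = fps_const (1/4) * (fps_X * bessel_fps)"
proof (rule fps_ext)
  fix m
  show "fps_nth (fps_X * fps_deriv (fps_deriv bessel_fps) + fps_deriv bessel_fps) m
    = fps_nth (fps_const (1/4) * (fps_X * bessel_fps)) m"
  proof (cases m)
    case 0
    then show ?thesis by (simp add: bessel_fps_def)
  next
    case (Suc l)
    show ?thesis
    proof (cases "even l")
      case True
      then obtain k where "l = 2 * k" by (auto elim: evenE)
      then show ?thesis
        by (simp add: Suc bessel_fps_def divide_simps power2_eq_square) (simp add: algebra_simps)
    next
      case False
      then show ?thesis by (simp add: Suc bessel_fps_def)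
    qed
  qed
qed

text \<open>Multiplying by the exponential turns the Bessel equation into Kummer's equation, whose
  coefficient recurrence has only two terms; the arcsine moments satisfy the same recurrence and
  start at 1.\<close>

lemma exp_bessel: "fps_exp (1/2) * bessel_fps = arcsine_fps 1"
proof -
  define H where "H = fps_exp (1/2) * bessel_fps"
  let ?h = "fps_const (1/2 :: real)" and ?G = bessel_fps and ?e = "fps_exp (1/2 :: real)"
  have q: "fps_const (1/4 :: real) = ?h * ?h" by simp
  have two: "?h + ?h = 1" by (simp flip: fps_const_1_eq_1)
  have D: "fps_deriv H = ?e * (fps_deriv ?G + ?h * ?G)"
    by (simp add: H_def algebra_simps)
  \<comment> \<open>The constant 1/2 stays symbolic as \<open>?h\<close> for the ring normalisation,
    so the use of 1/2 + 1/2 = 1 is isolated in the second summand.\<close>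
  have "fps_X * fps_deriv (fps_deriv H) + fps_deriv H - fps_X * fps_deriv H - ?h * H
    = ?e * (fps_X * fps_deriv (fps_deriv ?G) + fps_deriv ?G - ?h * ?h * (fps_X * ?G))
      + (?h + ?h - 1) * (?e * fps_X * fps_deriv ?G + ?h * (?e * fps_X * ?G))"
    by (simp add: D H_def algebra_simps del: fps_const_mult fps_const_add)
  also have "\<dots> = 0" using bessel_fps_ode two unfolding q by simp
  finally have ode: "fps_X * fps_deriv (fps_deriv H) + fps_deriv H = fps_X * fps_deriv H + ?h * H"
    by (simp add: algebra_simps)
  have rec: "(real j + 1)\<^sup>2 * fps_nth H (Suc j) = (real j + 1/2) * fps_nth H j" for j
    using arg_cong[OF ode, of "\<lambda>f. fps_nth f j"]
    by (cases j) (simp_all add: algebra_simps power2_eq_square)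
  have "fps_nth H j = arcsine 0 j / fact j" for j
  proof (induction j)
    case 0
    then show ?case by (simp add: H_def bessel_fps_def arcsine_def odd_fact_def)
  next
    case (Suc j)
    have "fps_nth H (Suc j) = (real j + 1/2) / (real j + 1)\<^sup>2 * fps_nth H j"
      using rec[of j] by (simp add: field_simps)
    then show ?case
      by (simp add: Suc arcsine_def odd_fact_rec power2_eq_square divide_simps) (simp add: algebra_simps)
  qed
  then show ?thesis by (simp add: H_def[symmetric] arcsine_fps_def fps_eq_iff)
qed

text \<open>Replacing t by -t in \<open>exp_bessel\<close> changes only the exponential, because
  \<open>bessel_fps\<close> is even.\<close>

lemma exp_neg_bessel: "fps_exp (-1/2) * bessel_fps = arcsine_fps (-1)"
proof (rule fps_ext)
  fix m
  have "fps_nth (arcsine_fps (-1)) m = (-1) ^ m * fps_nth (arcsine_fps 1) m"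
    by (simp add: arcsine_fps_def)
  also have "\<dots> = (\<Sum>i=0..m. (-1) ^ m * (fps_nth (fps_exp (1/2)) i * fps_nth bessel_fps (m - i)))"
    by (simp add: exp_bessel[symmetric] fps_mult_nth sum_distrib_left)
  also have "\<dots> = (\<Sum>i=0..m. fps_nth (fps_exp (-1/2)) i * fps_nth bessel_fps (m - i))"
  proof (intro sum.cong refl)
    fix i assume "i \<in> {0..m}"
    then have i: "m = i + (m - i)" by simp
    have "(-1) ^ m * ((1/2) ^ i) = (-1/2 :: real) ^ i" if "even (m - i)"
      using that by (subst i) (simp add: power_add power_minus[of "1/2"])
    then show "(-1) ^ m * (fps_nth (fps_exp (1/2)) i * fps_nth bessel_fps (m - i))
        = fps_nth (fps_exp (-1/2)) i * fps_nth bessel_fps (m - i)"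
      by (auto simp: bessel_fps_def)
  qed
  finally show "fps_nth (fps_exp (-1/2) * bessel_fps) m = fps_nth (arcsine_fps (-1)) m"
    by (simp add: fps_mult_nth)
qed

lemma parity_eigval_bessel: "parity_eigval m = fact m * fps_nth (bessel_fps * bessel_fps) m"
proof -
  have "bessel_fps * bessel_fps = (fps_exp (-1/2) * fps_exp (1/2)) * (bessel_fps * bessel_fps)"
    by (simp flip: fps_exp_add_mult)
  also have "\<dots> = arcsine_fps (-1) * arcsine_fps 1"
    by (simp add: exp_bessel[symmetric] exp_neg_bessel[symmetric] mult_ac)
  finally have "bessel_fps * bessel_fps = arcsine_fps (-1) * arcsine_fps 1" .
  moreover have "fact m * fps_nth (arcsine_fps (-1) * arcsine_fps 1) m = parity_eigval m"
    unfolding fps_mult_nth sum_distrib_left parity_eigval_def atLeast0AtMost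
    by (intro sum.cong) (simp_all add: arcsine_fps_def binomial_fact)
  ultimately show ?thesis by simp
qed

lemma parity_eigval_odd: "odd m \<Longrightarrow> parity_eigval m = 0"
  unfolding parity_eigval_bessel fps_mult_nth by (auto simp: bessel_fps_def intro!: sum.neutral)

text \<open>Only even indices contribute to the convolution, which becomes a sum of squared binomial
  coefficients and hence a central binomial coefficient.\<close>

lemma parity_eigval_even: "parity_eigval (2 * k) = burnside_eigval k"
proof -
  have "fps_nth (bessel_fps * bessel_fps) (2 * k)
    = (\<Sum>i\<in>(*) 2 ` {..k}. fps_nth bessel_fps i * fps_nth bessel_fps (2 * k - i))"
    unfolding fps_mult_nth
    by (intro sum.mono_neutral_right) (auto simp: bessel_fps_def elim!: evenE)
  also have "\<dots> = (\<Sum>i\<le>k. fps_nth bessel_fps (2 * i) * fps_nth bessel_fps (2 * k - 2 * i))"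
    by (subst sum.reindex) (auto simp: inj_on_def)
  also have "\<dots> = (\<Sum>i\<le>k. (real (k choose i))\<^sup>2 / (16 ^ k * (fact k)\<^sup>2))"
  proof (intro sum.cong refl)
    fix i assume "i \<in> {..k}"
    then have i: "i \<le> k" by simp
    have "(16 :: real) ^ k = 16 ^ i * 16 ^ (k - i)" using i by (simp flip: power_add)
    moreover have h: "(2 * k - 2 * i) div 2 = k - i" by simp
    ultimately show "fps_nth bessel_fps (2 * i) * fps_nth bessel_fps (2 * k - 2 * i)
        = (real (k choose i))\<^sup>2 / (16 ^ k * (fact k)\<^sup>2)"
      using i by (simp add: bessel_fps_def h binomial_fact field_simps power2_eq_square)
  qed
  also have "\<dots> = real ((2 * k) choose k) / (16 ^ k * (fact k)\<^sup>2)"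
    by (simp add: choose_square_sum[symmetric] sum_divide_distrib)
  finally have "parity_eigval (2 * k) = fact (2 * k) / (fact k * fact k) * real ((2 * k) choose k) / 16 ^ k"
    by (simp add: parity_eigval_bessel power2_eq_square)
  also have "fact (2 * k) / (fact k * fact k) = real ((2 * k) choose k)"
    by (simp add: binomial_fact mult_2)
  finally show ?thesis
    by (simp add: burnside_eigval_def power2_eq_square power_mult)
qed

section \<open>The nonzero eigenvalues are positive and distinct\<close>

lemma burnside_eigval_pos: "burnside_eigval k > 0"
  by (simp add: burnside_eigval_def)

text \<open>Consecutive central binomial coefficients have ratio \<open>4 * r\<close> with
  \<open>r < 1\<close>, so consecutive eigenvalues have ratio r squared.\<close>

lemma burnside_eigval_Suc: "burnside_eigval (Suc k) < burnside_eigval k"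
proof -
  define r where "r = (2 * real k + 1) / (2 * real k + 2)"
  have "real ((2 * Suc k) choose Suc k) = fact (2 * Suc k) / (fact (Suc k) * fact (Suc k))"
    using binomial_fact[of "Suc k" "2 * Suc k", where ?'a = real] by simp
  also have "fact (2 * Suc k) = (2 * real k + 2) * (2 * real k + 1) * fact (2 * k)"
    by (simp add: algebra_simps)
  also have "(2 * real k + 2) * (2 * real k + 1) * fact (2 * k) / (fact (Suc k) * fact (Suc k))
    = 4 * r * (fact (2 * k) / (fact k * fact k))"
    unfolding r_def fact_Suc of_nat_Suc by (simp add: divide_simps) algebra
  also have "fact (2 * k) / (fact k * fact k) = real ((2 * k) choose k)"
    by (simp add: binomial_fact mult_2)
  finally have "real ((2 * Suc k) choose Suc k) = 4 * r * real ((2 * k) choose k)" .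
  then have "burnside_eigval (Suc k) = r\<^sup>2 * burnside_eigval k"
    by (simp add: burnside_eigval_def power_mult_distrib power_add)
  moreover have "r\<^sup>2 < 1" by (simp add: r_def abs_square_less_1)
  ultimately show ?thesis using burnside_eigval_pos[of k] by simp
qed

lemma burnside_eigval_eq_iff: "burnside_eigval j = burnside_eigval k \<longleftrightarrow> j = k"
  using lift_Suc_mono_less[of "\<lambda>k. - burnside_eigval k" j k]
    lift_Suc_mono_less[of "\<lambda>k. - burnside_eigval k" k j] burnside_eigval_Suc
  by (cases j k rule: linorder_cases) auto

section \<open>Linear independence of the eigenvectors\<close>

lemma sum_parity_eigvec:
  assumes "\<not> S \<subseteq> T"
  shows "(\<Sum>x\<in>UNIV. parity S x * eigvec T $ x) = 0" (is "?s = 0")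
proof -
  obtain a where a: "a \<in> S" "a \<notin> T" using assms by auto
  have "?s = - ?s"
    \<comment> \<open>Flipping \<open>a\<close> negates the parity of \<open>S\<close> and leaves
      \<open>eigvec T\<close> unchanged.\<close>
    using a by (subst sum_flip[of _ a, symmetric]) (simp add: parity_flip eigvec_def ones_in_flip sum_negf)
  then show ?thesis by simp
qed

lemma sum_parity_eigvec_pos: "(\<Sum>x\<in>UNIV. parity S x * eigvec S $ x) > 0"
proof (rule sum_pos)
  fix x
  have "parity S x * eigvec S $ x = (parity S x * parity S x) * real (card S choose ones_in S x)"
    by (simp only: eigvec_def parity_def vec_lambda_beta mult.assoc)
  then show "parity S x * eigvec S $ x > 0" by (simp add: ones_in_le)
qed auto

text \<open>The pairing with the parities is triangular with respect to inclusion, so a maximal \<open>S\<close> with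
  nonzero coefficient yields a contradiction.\<close>

lemma eigvec_lin_indep:
  assumes "(\<Sum>T\<in>UNIV. c T *\<^sub>R eigvec T) = 0"
  shows "c S = 0"
proof (rule ccontr)
  assume "c S \<noteq> 0"
  then have "{T. c T \<noteq> 0} \<noteq> {}" by auto
  from finite_has_maximal[OF _ this] obtain M where M: "c M \<noteq> 0" "\<And>T. c T \<noteq> 0 \<Longrightarrow> M \<subseteq> T \<Longrightarrow> M = T"
    by auto
  have "0 = (\<Sum>x\<in>UNIV. parity M x * (\<Sum>T\<in>UNIV. c T *\<^sub>R eigvec T) $ x)"
    using assms by simp
  also have "\<dots> = (\<Sum>x\<in>UNIV. \<Sum>T\<in>UNIV. c T * (parity M x * eigvec T $ x))"
    by (simp add: sum_distrib_left mult_ac)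
  also have "\<dots> = (\<Sum>T\<in>UNIV. c T * (\<Sum>x\<in>UNIV. parity M x * eigvec T $ x))"
    by (subst sum.swap) (simp add: sum_distrib_left)
  also have "\<dots> = (\<Sum>T\<in>{M}. c T * (\<Sum>x\<in>UNIV. parity M x * eigvec T $ x))"
  proof (intro sum.mono_neutral_right ballI)
    fix T assume "T \<in> UNIV - {M}"
    then show "c T * (\<Sum>x\<in>UNIV. parity M x * eigvec T $ x) = 0"
      using M(2)[of T] sum_parity_eigvec[of M T] by (cases "M \<subseteq> T") auto
  qed auto
  finally show False using M(1) sum_parity_eigvec_pos[of M] by simp
qed

section \<open>Eigenspaces of a matrix with a known eigenbasis\<close>

lemma family_independent:
  fixes v :: "'i \<Rightarrow> 'a::real_vector"
  assumes "finite I" "\<forall>c. (\<Sum>i\<in>I. c i *\<^sub>R v i) = 0 \<longrightarrow> (\<forall>i\<in>I. c i = 0)"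
  shows "inj_on v I" "independent (v ` I)"
proof -
  show inj: "inj_on v I"
  proof (rule inj_onI, rule ccontr)
    fix i j assume ij: "i \<in> I" "j \<in> I" "v i = v j" "i \<noteq> j"
    \<comment> \<open>A repeated vector would give the nontrivial relation v i - v j = 0.\<close>
    let ?c = "\<lambda>l. (if l = i then 1 else 0) - (if l = j then 1 else 0) :: real"
    have "(\<Sum>l\<in>I. ?c l *\<^sub>R v l) = v i - v j"
      using assms(1) ij by (simp add: scaleR_left_diff_distrib sum_subtractf if_distrib[of "\<lambda>c. c *\<^sub>R _"] cong: if_cong)
    then show False using spec[OF assms(2), of ?c] ij by auto
  qed
  show "independent (v ` I)"
  proof (rule independent_if_scalars_zero)
    fix f x assume "(\<Sum>x\<in>v ` I. f x *\<^sub>R x) = 0" "x \<in> v ` I"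
    then show "f x = 0"
      using spec[OF assms(2), of "f \<circ> v"] by (auto simp: sum.reindex[OF inj])
  qed (use assms(1) in simp)
qed

text \<open>Expanding an eigenvector in the basis and comparing coefficients kills every coordinate
  whose eigenvalue is not the given one.\<close>

lemma eigenspace_of_eigenbasis:
  fixes A :: "real ^ 'm::finite ^ 'm" and v :: "'i \<Rightarrow> real ^ 'm"
  assumes I: "finite I" "card I = CARD('m)"
    and li: "\<forall>c. (\<Sum>i\<in>I. c i *\<^sub>R v i) = 0 \<longrightarrow> (\<forall>i\<in>I. c i = 0)"
    and A: "\<And>i. i \<in> I \<Longrightarrow> A *v v i = l i *\<^sub>R v i"
  shows "eigenspace A \<mu> = span (v ` {i \<in> I. l i = \<mu>})"
proof -
  note inj = family_independent(1)[OF I(1) li] and ind = family_independent(2)[OF I(1) li]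
  have span: "span (v ` I) = UNIV"
    \<comment> \<open>As many independent vectors as the dimension must span.\<close>
    using card_eq_dim[of "v ` I" UNIV] ind I by (auto simp: card_image[OF inj])
  show ?thesis
  proof (intro equalityI subsetI)
    fix u assume "u \<in> eigenspace A \<mu>"
    then have u: "A *v u = \<mu> *\<^sub>R u" by (simp add: eigenspace_def)
    have "u \<in> range (\<lambda>f. \<Sum>x\<in>v ` I. f x *\<^sub>R x)"
      using span span_finite[of "v ` I"] I(1) by simp
    then obtain f where "u = (\<Sum>x\<in>v ` I. f x *\<^sub>R x)" by blast
    then have f: "u = (\<Sum>i\<in>I. f (v i) *\<^sub>R v i)" by (simp add: sum.reindex[OF inj])
    have "A *v u = (\<Sum>i\<in>I. (f (v i) * l i) *\<^sub>R v i)"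
      by (simp add: f linear_sum[OF matrix_vector_mul_linear] matrix_vector_mult_scaleR A)
    then have "(\<Sum>i\<in>I. (f (v i) * (l i - \<mu>)) *\<^sub>R v i) = 0"
      using u by (simp add: f algebra_simps sum_subtractf scaleR_sum_right)
    then have z: "f (v i) = 0" if "i \<in> I" "l i \<noteq> \<mu>" for i
      using spec[OF li, of "\<lambda>i. f (v i) * (l i - \<mu>)"] that by auto
    have "u = (\<Sum>i\<in>{i \<in> I. l i = \<mu>}. f (v i) *\<^sub>R v i)"
      unfolding f using I(1) z by (intro sum.mono_neutral_right) auto
    then show "u \<in> span (v ` {i \<in> I. l i = \<mu>})"
      by (simp only:) (intro span_sum span_scale span_base imageI)
  next
    fix u assume "u \<in> span (v ` {i \<in> I. l i = \<mu>})"
    moreover have "subspace (eigenspace A \<mu>)"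
      by (auto simp: subspace_def eigenspace_def matrix_vector_right_distrib matrix_vector_mult_scaleR scaleR_right_distrib)
    moreover have "v ` {i \<in> I. l i = \<mu>} \<subseteq> eigenspace A \<mu>"
      by (auto simp: eigenspace_def A)
    ultimately show "u \<in> eigenspace A \<mu>" using span_minimal by blast
  qed
qed

section \<open>Multiplicities and conclusion\<close>

lemma card_odd_subsets: "card {S :: 'n::finite set. odd (card S)} = 2 ^ (CARD('n) - 1)"
proof -
  let ?n = "CARD('n)"
  have "card {S :: 'n set. odd (card S)} = (\<Sum>S\<in>(UNIV :: 'n set set). if odd (card S) then 1 else 0)"
    by (simp add: sum.If_cases)
  also have "\<dots> = (\<Sum>j\<le>?n. \<Sum>S | S \<in> (UNIV :: 'n set set) \<and> card S = j. if odd (card S) then 1 else 0)"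
    by (rule sum.group[symmetric]) (auto intro: card_mono)
  also have "\<dots> = (\<Sum>j\<le>?n. if odd j then ?n choose j else 0)"
    using n_subsets[of "UNIV :: 'n set"] by (intro sum.cong) auto
  finally have "2 * int (card {S :: 'n set. odd (card S)}) = 2 * (\<Sum>j\<le>?n. if odd j then int (?n choose j) else 0)"
    by (simp add: if_distrib[of int] cong: if_cong)
  also have "\<dots> = 2 ^ ?n" using choose_odd_sum[of ?n, where ?'a = int] by simp
  also have "\<dots> = 2 * 2 ^ (?n - 1)" by (cases ?n) auto
  finally show ?thesis by simp
qed

theorem theorem1p2:
  fixes K :: "real ^ (bool ^ 'n::finite) ^ (bool ^ 'n)" and n :: nat
  assumes "n = CARD('n)"
    and "K = burnside_matrix"
  shows "{c. is_eigenvalue K c} = {0} \<union> {burnside_eigval k |k. k \<le> n div 2} \<and>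
         dim (eigenspace K 0) = 2 ^ (n - 1) \<and>
         (\<forall>k \<le> n div 2. dim (eigenspace K (burnside_eigval k)) = n choose (2 * k)) \<and>
         (\<forall>k \<le> n div 2.
            independent {burnside_eigvec k S |S :: 'n set. card S = 2 * k} \<and>
            span {burnside_eigvec k S |S :: 'n set. card S = 2 * k} = eigenspace K (burnside_eigval k))"
proof -
  let ?v = "eigvec :: 'n set \<Rightarrow> _"
  let ?J = "\<lambda>\<mu>. {S :: 'n set. parity_eigval (card S) = \<mu>}"
  have li: "\<forall>c. (\<Sum>T\<in>UNIV. c T *\<^sub>R ?v T) = 0 \<longrightarrow> (\<forall>T\<in>UNIV. c T = 0)"
    using eigvec_lin_indep by blast
  have inj: "inj_on ?v T" and ind: "independent (?v ` T)" for T
    using family_independent[OF finite li] inj_on_subset independent_mono[OF _ image_mono[of T UNIV]] by blast+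
  have E: "eigenspace K \<mu> = span (?v ` ?J \<mu>)" for \<mu>
    using eigenspace_of_eigenbasis[OF finite _ li, of K "\<lambda>S. parity_eigval (card S)" \<mu>]
    by (simp add: assms(2) burnside_matrix_mult_eigvec card_UNIV_set)
  have dim: "dim (eigenspace K \<mu>) = card (?J \<mu>)" for \<mu>
    by (simp add: E dim_eq_card_independent[OF ind] card_image[OF inj])
  have val: "parity_eigval m = (if even m then burnside_eigval (m div 2) else 0)" for m
    by (auto elim!: evenE simp: parity_eigval_even parity_eigval_odd)
  \<comment> \<open>Positivity separates even sizes from odd ones, and distinctness then recovers
    the size from a nonzero eigenvalue, so no two eigenspaces merge.\<close>
  have J0: "?J 0 = {S. odd (card S)}"
    using burnside_eigval_pos by (auto simp: val less_imp_neq[symmetric])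
  have J: "?J (burnside_eigval k) = {S. card S = 2 * k}" for k
    using burnside_eigval_pos[of k] by (auto simp: val burnside_eigval_eq_iff)
  have dim0: "dim (eigenspace K 0) = 2 ^ (n - 1)"
    by (simp add: dim J0 card_odd_subsets assms(1))
  have dimk: "dim (eigenspace K (burnside_eigval k)) = n choose (2 * k)" for k
    using n_subsets[of "UNIV :: 'n set" "2 * k"] by (simp add: dim J assms(1))
  have B: "{burnside_eigvec k S |S :: 'n set. card S = 2 * k} = ?v ` {S. card S = 2 * k}" for k
    by (auto simp: burnside_eigvec_def eigvec_def image_iff)
  have ev: "is_eigenvalue K c \<longleftrightarrow> dim (eigenspace K c) \<noteq> 0" for c
    by (auto simp: is_eigenvalue_def eigenspace_def)
  have "is_eigenvalue K c \<longleftrightarrow> c = 0 \<or> (\<exists>k\<le>n div 2. c = burnside_eigval k)" for c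
  proof
    assume "is_eigenvalue K c"
    then have "?J c \<noteq> {}" by (auto simp: ev dim)
    then obtain S :: "'n set" where S: "c = parity_eigval (card S)" by auto
    have "card S \<le> n" by (simp add: assms(1) card_mono)
    then have "card S div 2 \<le> n div 2" by (rule div_le_mono)
    then show "c = 0 \<or> (\<exists>k\<le>n div 2. c = burnside_eigval k)" by (auto simp: S val)
  next
    assume "c = 0 \<or> (\<exists>k\<le>n div 2. c = burnside_eigval k)"
    \<comment> \<open>The dimensions found are nonzero: a power of 2, and a binomial coefficient
      with 2k at most n.\<close>
    then show "is_eigenvalue K c" by (auto simp: ev dim0 dimk simp del: dim_eq_0)
  qed
  then have "{c. is_eigenvalue K c} = {0} \<union> {burnside_eigval k |k. k \<le> n div 2}" by auto
  then show ?thesis using dim0 dimk ind by (simp add: B E J)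
qed

end
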